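(* Let $n \ge k \ge 2$ be integers. Then \[ \mathbb{P}\big( G \sim \mathbb{G}(n,1/2) \text{ is a } k\text{-Ramsey graph} \big) = (-1)^{\binom{n}{k}}\, 2^{\left(1-\binom{k}{2}\right)\binom{n}{k}} \cdot Q_{n,k}\!\left(1 - 2^{\binom{k}{2}-1}\right). \]
   Context: $[n]=\{1,\dots,n\}$; $\binom{S}{j}$ is the set of $j$-element subsets of $S$. $\mathbb{G}(n,1/2)$ is the Erdős–Rényi random graph on $[n]$ with edge probability $1/2$. A graph is $k$-Ramsey if it contains no clique of size $k$ and no independent set of size $k$. Let $\mathcal{B}$ be the set of assignments $\mathfrak{h}$ which associate to each $S\in\binom{[n]}{k}$ a finite simple undirected graph $\mathfrak{h}_S$ on vertex set $S$ such that (i) for every $S$, $|\mathbf{E}(\mathfrak{h}_S)|$ is even, and (ii) for every $e\in\binom{[n]}{2}$, the number of $S\in\binom{[n]}{k}$ with $e\in\mathbf{E}(\mathfrak{h}_S)$ is even. For $\mathfrak{h}\in\mathcal{B}$, $\mathrm{Empty}(\mathfrak{h}) := \{S\in\binom{[n]}{k} : \mathfrak{h}_S \text{ has no edges}\}$. Define $Q_{n,k}(t) := \sum_{\mathfrak{h}\in\mathcal{B}} t^{|\mathrm{Empty}(\mathfrak{h})|}\in\mathbb{Z}[t]$. *)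

theory Defs
  imports
    "HOL-Probability.Probability"
    "HOL-Probability.Product_PMF"
    "HOL-Library.Ramsey"
    "HOL-Computational_Algebra.Polynomial"
begin

text \<open>
  A finite simple undirected graph on a known vertex set \<open>V\<close> is represented by its edge set, a
  subset of \<open>[V]\<^bsup>2\<^esup>\<close>.
\<close>

definition graphs_on :: "'a set \<Rightarrow> 'a set set set" where
  "graphs_on V = Pow ([V]\<^bsup>2\<^esup>)"

definition erdos_renyi :: "nat \<Rightarrow> real \<Rightarrow> nat set set pmf" where
  "erdos_renyi n p =
     map_pmf (\<lambda>b. {e \<in> [{1..n}]\<^bsup>2\<^esup>. b e})
       (Pi_pmf ([{1..n}]\<^bsup>2\<^esup>) False (\<lambda>_. bernoulli_pmf p))"

definition k_Ramsey :: "nat \<Rightarrow> 'a set \<Rightarrow> 'a set set \<Rightarrow> bool" where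
  "k_Ramsey k V E \<longleftrightarrow> \<not> (\<exists>S \<in> [V]\<^bsup>k\<^esup>. clique S E) \<and> \<not> (\<exists>S \<in> [V]\<^bsup>k\<^esup>. indep S E)"

text \<open>
  Assignments are extensional functions (\<open>undefined\<close> off \<open>[{1..n}]\<^bsup>k\<^esup>\<close>), so that
  each one is counted exactly once.
\<close>

definition even_assignments :: "nat \<Rightarrow> nat \<Rightarrow> (nat set \<Rightarrow> nat set set) set" where
  "even_assignments n k =
     {h \<in> (\<Pi>\<^sub>E S \<in> [{1..n}]\<^bsup>k\<^esup>. graphs_on S).
        (\<forall>S \<in> [{1..n}]\<^bsup>k\<^esup>. even (card (h S))) \<and>
        (\<forall>e \<in> [{1..n}]\<^bsup>2\<^esup>. even (card {S \<in> [{1..n}]\<^bsup>k\<^esup>. e \<in> h S}))}"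

definition Empty :: "nat \<Rightarrow> nat \<Rightarrow> (nat set \<Rightarrow> nat set set) \<Rightarrow> nat set set" where
  "Empty n k h = {S \<in> [{1..n}]\<^bsup>k\<^esup>. h S = {}}"

definition Q_poly :: "nat \<Rightarrow> nat \<Rightarrow> int poly" where
  "Q_poly n k = (\<Sum>h \<in> even_assignments n k. monom 1 (card (Empty n k h)))"

end

theory Submission
  imports Defs
begin

text \<open>
  Fourier analysis on the cube of graphs. Summing the characters
  \<open>(-1)\<^bsup>|F \<inter> G|\<^esup>\<close> over the even subgraphs \<open>F\<close> of the complete graph on a \<open>k\<close>-set \<open>S\<close>
  gives \<open>M = 2\<^bsup>(k choose 2) - 1\<^esup>\<close> if \<open>S\<close> is a clique or independent in \<open>G\<close>, and 0 otherwise.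
  Hence the indicator that \<open>S\<close> is neither is \<open>-1/M\<close> times the same sum with the trivial character
  reweighted by \<open>1 - M\<close>. Multiplying over all \<open>S\<close> and averaging over \<open>G\<close>, orthogonality of
  characters leaves exactly the assignments covering every edge an even number of times.
\<close>

text \<open>For finite \<open>F\<close>, the product of \<open>sign_at G e\<close> over
  \<open>e \<in> F\<close> is the character (-1)^|F \<inter> G|. The product form lets sums over
  subsets factor edge by edge.\<close>

definition sign_at :: "'a set \<Rightarrow> 'a \<Rightarrow> real" where
  "sign_at G e = (if e \<in> G then - 1 else 1)"

lemma sum_Pow_prod:
  fixes f :: "'a \<Rightarrow> 'b :: comm_semiring_1"
  assumes "finite A"
  shows "(\<Sum>F\<in>Pow A. \<Prod>e\<in>F. f e) = (\<Prod>e\<in>A. f e + 1)"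
  using prod_add[OF assms, of f "\<lambda>_. 1"] by simp

text \<open>Adding the subset sums for \<open>f\<close> and \<open>- f\<close> cancels the subsets
  of odd size and doubles those of even size; each full subset sum factors.\<close>

lemma sum_even_subsets_prod:
  fixes f :: "'a \<Rightarrow> real"
  assumes "finite A"
  shows "2 * (\<Sum>F | F \<subseteq> A \<and> even (card F). \<Prod>e\<in>F. f e) =
    (\<Prod>e\<in>A. f e + 1) + (\<Prod>e\<in>A. 1 - f e)"
proof -
  have "(\<Sum>F\<in>Pow A. \<Prod>e\<in>F. f e) + (\<Sum>F\<in>Pow A. \<Prod>e\<in>F. - f e) =
      (\<Sum>F\<in>Pow A. if even (card F) then 2 * (\<Prod>e\<in>F. f e) else 0)"
    unfolding sum.distrib[symmetric]
    by (intro sum.cong) (auto simp: prod_uminus)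
  also have "\<dots> = (\<Sum>F | F \<subseteq> A \<and> even (card F). 2 * (\<Prod>e\<in>F. f e))"
    using assms by (intro sum.mono_neutral_cong_right) auto
  finally have "(\<Sum>F\<in>Pow A. \<Prod>e\<in>F. f e) + (\<Sum>F\<in>Pow A. \<Prod>e\<in>F. - f e) =
      2 * (\<Sum>F | F \<subseteq> A \<and> even (card F). \<Prod>e\<in>F. f e)"
    by (simp add: sum_distrib_left)
  then show ?thesis
    using sum_Pow_prod[OF assms, of f] sum_Pow_prod[OF assms, of "\<lambda>e. - f e"] by simp
qed

text \<open>For \<open>f = sign_at G\<close> every factor of the two products is 0 or 2. One product
  survives only if \<open>A\<close> misses \<open>G\<close>, the other only if
  \<open>A \<subseteq> G\<close>; as \<open>A\<close> is nonempty, never both. Halving gives the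
  exponent \<open>card A - 1\<close>.\<close>

lemma sum_even_subsets_sign:
  assumes "finite A" "A \<noteq> {}"
  shows "(\<Sum>F | F \<subseteq> A \<and> even (card F). \<Prod>e\<in>F. sign_at G e) =
    (if A \<subseteq> G \<or> A \<inter> G = {} then 2 ^ (card A - 1) else 0)"
proof -
  have pow: "(2::real) ^ card A = 2 * 2 ^ (card A - 1)"
    using assms by (metis One_nat_def Suc_pred card_gt_0_iff power_Suc)
  have plus: "(\<Prod>e\<in>A. sign_at G e + 1) = (if A \<inter> G = {} then 2 ^ card A else 0)"
  proof (cases "A \<inter> G = {}")
    case True
    then have "(\<Prod>e\<in>A. sign_at G e + 1) = (\<Prod>e\<in>A. 2)"
      by (intro prod.cong) (auto simp: sign_at_def)
    then show ?thesis using True by simp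
  qed (use assms in \<open>auto simp: sign_at_def prod_zero_iff\<close>)
  have minus: "(\<Prod>e\<in>A. 1 - sign_at G e) = (if A \<subseteq> G then 2 ^ card A else 0)"
  proof (cases "A \<subseteq> G")
    case True
    then have "(\<Prod>e\<in>A. 1 - sign_at G e) = (\<Prod>e\<in>A. 2)"
      by (intro prod.cong) (auto simp: sign_at_def)
    then show ?thesis using True by simp
  qed (use assms in \<open>auto simp: sign_at_def prod_zero_iff\<close>)
  have "\<not> (A \<subseteq> G \<and> A \<inter> G = {})"
    using assms by auto
  then show ?thesis
    using sum_even_subsets_prod[OF assms(1), of "sign_at G"] plus minus pow
    by (auto split: if_splits)
qed

text \<open>Orthogonality of characters: regrouped by edges, the summand is a product over
  \<open>e \<in> G\<close> of (-1)^\<open>c e\<close>, so the sum over \<open>G\<close> factors into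
  terms \<open>(- 1) ^ c e + 1\<close>, and one odd \<open>c e\<close> makes it vanish.\<close>

lemma sum_Pow_prod_sign:
  assumes "finite X" "finite K" "\<And>S. S \<in> K \<Longrightarrow> h S \<subseteq> X"
  shows "(\<Sum>G\<in>Pow X. \<Prod>S\<in>K. \<Prod>e\<in>h S. sign_at G e) =
    (if \<forall>e\<in>X. even (card {S \<in> K. e \<in> h S}) then 2 ^ card X else 0)"
proof -
  define c where "c e = card {S \<in> K. e \<in> h S}" for e
  have "(\<Prod>S\<in>K. \<Prod>e\<in>h S. sign_at G e) = (\<Prod>e\<in>G. (- 1) ^ c e)" if "G \<in> Pow X" for G
  proof -
    have "(\<Prod>S\<in>K. \<Prod>e\<in>h S. sign_at G e) = (\<Prod>S\<in>K. \<Prod>e | e \<in> X \<and> e \<in> h S. sign_at G e)"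
      using assms(3) by (intro prod.cong) auto
    also have "\<dots> = (\<Prod>e\<in>X. \<Prod>S | S \<in> K \<and> e \<in> h S. sign_at G e)"
      using assms by (intro prod.swap_restrict) auto
    also have "\<dots> = (\<Prod>e\<in>X. sign_at G e ^ c e)"
      by (simp add: c_def)
    also have "\<dots> = (\<Prod>e\<in>G. (- 1) ^ c e)"
      using assms that by (intro prod.mono_neutral_cong_right) (auto simp: sign_at_def)
    finally show ?thesis .
  qed
  then have "(\<Sum>G\<in>Pow X. \<Prod>S\<in>K. \<Prod>e\<in>h S. sign_at G e) = (\<Prod>e\<in>X. (- 1) ^ c e + 1)"
    using sum_Pow_prod[OF assms(1), of "\<lambda>e. (- 1 :: real) ^ c e"] by simp
  also have "\<dots> = (if \<forall>e\<in>X. even (c e) then 2 ^ card X else 0)"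
  proof (cases "\<forall>e\<in>X. even (c e)")
    case True
    then have "(\<Prod>e\<in>X. (- 1 :: real) ^ c e + 1) = (\<Prod>e\<in>X. 2)"
      by (intro prod.cong) auto
    then show ?thesis using True by simp
  qed (use assms in \<open>auto simp: prod_zero_iff intro!: bexI\<close>)
  finally show ?thesis unfolding c_def .
qed

lemma clique_iff_nsets: "clique S E \<longleftrightarrow> [S]\<^bsup>2\<^esup> \<subseteq> E"
  by (auto simp: clique_def nsets_2_eq)

lemma indep_iff_nsets: "indep S E \<longleftrightarrow> [S]\<^bsup>2\<^esup> \<inter> E = {}"
  by (auto simp: indep_def nsets_2_eq)

text \<open>The empty graph has character 1, so weighting it by \<open>1 - M\<close> lowers the
  character sum by \<open>M\<close>: from \<open>M\<close> to 0 for a clique or independent set,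
  from 0 to \<open>- M\<close> otherwise.\<close>

lemma indicator_neither_clique_nor_indep:
  assumes "card S = k" "2 \<le> k"
  defines "M \<equiv> 2 ^ ((k choose 2) - 1) :: real"
  shows "(of_bool (\<not> clique S G \<and> \<not> indep S G) :: real) =
    (- 1 / M) * (\<Sum>F | F \<in> graphs_on S \<and> even (card F).
      (if F = {} then 1 - M else 1) * (\<Prod>e\<in>F. sign_at G e))"
proof -
  let ?A = "[S]\<^bsup>2\<^esup>" and ?E = "{F. F \<in> graphs_on S \<and> even (card F)}"
  have S: "finite S"
    using assms(1,2) by (metis card.infinite not_numeral_le_zero)
  have A: "finite ?A" "?A \<noteq> {}" "card ?A = k choose 2"
    using assms(1,2) S by (auto simp: finite_imp_finite_nsets nsets_eq_empty_iff)
  have E: "?E = {F. F \<subseteq> ?A \<and> even (card F)}"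
    by (auto simp: graphs_on_def)
  have fin: "finite ?E"
    unfolding E by (rule finite_subset[of _ "Pow ?A"]) (use A(1) in auto)
  have "(\<Sum>F\<in>?E. (if F = {} then 1 - M else 1) * (\<Prod>e\<in>F. sign_at G e)) =
      (\<Sum>F\<in>?E. (\<Prod>e\<in>F. sign_at G e) - (if F = {} then M else 0))"
    by (intro sum.cong) auto
  also have "\<dots> = (\<Sum>F\<in>?E. \<Prod>e\<in>F. sign_at G e) - M"
    unfolding sum_subtractf using fin by (simp add: sum.delta graphs_on_def)
  also have "(\<Sum>F\<in>?E. \<Prod>e\<in>F. sign_at G e) = (if clique S G \<or> indep S G then M else 0)"
    unfolding E sum_even_subsets_sign[OF A(1,2)] clique_iff_nsets indep_iff_nsets A(3) M_def ..
  finally show ?thesis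
    by (simp add: M_def)
qed

text \<open>Independent fair coins make the random edge set uniform on the power set, so probability
  becomes counting.\<close>

lemma prob_erdos_renyi_half:
  "measure_pmf.prob (erdos_renyi n (1/2)) {G. P G} =
    (\<Sum>G\<in>Pow ([{1..n}]\<^bsup>2\<^esup>). of_bool (P G)) / 2 ^ card ([{1..n}]\<^bsup>2\<^esup>)"
proof -
  let ?X = "[{1..n}]\<^bsup>2\<^esup>"
  have fin: "finite ?X" by (simp add: finite_imp_finite_nsets)
  then have "measure_pmf.prob (erdos_renyi n (1/2)) {G. P G} =
      real (card (Pow ?X \<inter> {G. P G})) / real (card (Pow ?X))"
    unfolding erdos_renyi_def
    by (subst pmf_of_set_Pow_conv_bernoulli) (auto intro!: measure_pmf_of_set)
  then show ?thesis using fin by (simp add: card_Pow)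
qed

theorem theorem2p5:
  fixes n k :: nat
  assumes "2 \<le> k" and "k \<le> n"
  shows "measure_pmf.prob (erdos_renyi n (1/2)) {G. k_Ramsey k {1..n} G} =
    (- 1) ^ (n choose k) * 2 powi ((1 - int (k choose 2)) * int (n choose k)) *
      real_of_int (poly (Q_poly n k) (1 - 2 ^ ((k choose 2) - 1)))"
proof -
  define X where "X = [{1..n}]\<^bsup>2\<^esup>"
  define K where "K = [{1..n}]\<^bsup>k\<^esup>"
  define M :: real where "M = 2 ^ ((k choose 2) - 1)"
  define w :: "nat set set \<Rightarrow> real" where "w F = (if F = {} then 1 - M else 1)" for F
  define D where "D S = {F. F \<in> graphs_on S \<and> even (card F)}" for S :: "nat set"
  have finX: "finite X" and finK: "finite K"
    by (simp_all add: X_def K_def finite_imp_finite_nsets)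
  have cardK: "card K = n choose k"
    by (simp add: K_def)
  have K: "finite S" "card S = k" "graphs_on S \<subseteq> Pow X" if "S \<in> K" for S
    using that nsets_mono[of S "{1..n}" 2]
    by (auto simp: K_def nsets_def graphs_on_def X_def)
  have finD: "finite (D S)" if "S \<in> K" for S
    using K(3)[OF that] finX by (intro finite_subset[of "D S" "Pow X"]) (auto simp: D_def)
  have Ramsey: "of_bool (k_Ramsey k {1..n} G) =
      (- 1 / M) ^ card K * (\<Sum>h\<in>Pi\<^sub>E K D. (\<Prod>S\<in>K. w (h S)) * (\<Prod>S\<in>K. \<Prod>e\<in>h S. sign_at G e))"
    for G
  proof -
    have "of_bool (k_Ramsey k {1..n} G) = (\<Prod>S\<in>K. of_bool (\<not> clique S G \<and> \<not> indep S G) :: real)"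
      using finK by (auto simp: k_Ramsey_def K_def)
    also have "\<dots> = (\<Prod>S\<in>K. (- 1 / M) * (\<Sum>F\<in>D S. w F * (\<Prod>e\<in>F. sign_at G e)))"
    proof (rule prod.cong[OF refl])
      fix S assume "S \<in> K"
      then show "of_bool (\<not> clique S G \<and> \<not> indep S G) =
          (- 1 / M) * (\<Sum>F\<in>D S. w F * (\<Prod>e\<in>F. sign_at G e))"
        unfolding D_def w_def M_def
        by (intro indicator_neither_clique_nor_indep K(2) assms(1))
    qed
    also have "\<dots> = (- 1 / M) ^ card K * (\<Prod>S\<in>K. \<Sum>F\<in>D S. w F * (\<Prod>e\<in>F. sign_at G e))"
      by (simp only: prod.distrib prod_constant)
    \<comment> \<open>Expanding the product of sums picks one even graph per \<open>S\<close>, that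
      is, an \<open>h\<close> in \<open>Pi\<^sub>E K D\<close>.\<close>
    finally show ?thesis
      by (subst (asm) prod_sum_PiE[OF finK finD]) (auto simp: prod.distrib)
  qed
  \<comment> \<open>\<open>D\<close> already encodes the parity of each graph; only the parity of
    the edge covers remains, which orthogonality detects.\<close>
  have even: "even_assignments n k =
      {h \<in> Pi\<^sub>E K D. \<forall>e\<in>X. even (card {S \<in> K. e \<in> h S})}"
    unfolding even_assignments_def X_def[symmetric] K_def[symmetric]
    by (auto simp: D_def PiE_iff)
  have weight: "(\<Prod>S\<in>K. w (h S)) = (1 - M) ^ card (Empty n k h)" for h
  proof -
    have "(\<Prod>S\<in>K. w (h S)) = (\<Prod>S\<in>Empty n k h. 1 - M)"
      using finK by (intro prod.mono_neutral_cong_right) (auto simp: Empty_def K_def w_def)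
    then show ?thesis by simp
  qed
  have "(\<Sum>G\<in>Pow X. of_bool (k_Ramsey k {1..n} G)) = (- 1 / M) ^ card K *
      (\<Sum>h\<in>Pi\<^sub>E K D. (\<Prod>S\<in>K. w (h S)) * (\<Sum>G\<in>Pow X. \<Prod>S\<in>K. \<Prod>e\<in>h S. sign_at G e))"
    unfolding Ramsey sum_distrib_left[symmetric]
    by (subst sum.swap) (simp only: sum_distrib_left)
  also have "(\<Sum>h\<in>Pi\<^sub>E K D. (\<Prod>S\<in>K. w (h S)) * (\<Sum>G\<in>Pow X. \<Prod>S\<in>K. \<Prod>e\<in>h S. sign_at G e)) =
      (\<Sum>h\<in>Pi\<^sub>E K D. (1 - M) ^ card (Empty n k h) *
        (if \<forall>e\<in>X. even (card {S \<in> K. e \<in> h S}) then 2 ^ card X else 0))"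
  proof (intro sum.cong refl arg_cong2[of _ _ _ _ "(*)"] weight sum_Pow_prod_sign finX finK)
    fix h S assume "h \<in> Pi\<^sub>E K D" "S \<in> K"
    then show "h S \<subseteq> X"
      using K(3)[of S] by (auto simp: D_def PiE_iff)
  qed
  also have "\<dots> = (\<Sum>h\<in>even_assignments n k. (1 - M) ^ card (Empty n k h) * 2 ^ card X)"
    unfolding even using finK finD
    by (intro sum.mono_neutral_cong_right) (auto intro!: finite_PiE)
  \<comment> \<open>The factor \<open>2 ^ card X\<close> from orthogonality will cancel against the
    number of graphs in the uniform average.\<close>
  also have "\<dots> = 2 ^ card X * real_of_int (poly (Q_poly n k) (1 - 2 ^ ((k choose 2) - 1)))"
    by (simp add: Q_poly_def poly_sum poly_monom M_def sum_distrib_left mult.commute)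
  finally have "measure_pmf.prob (erdos_renyi n (1/2)) {G. k_Ramsey k {1..n} G} =
      (- 1 / M) ^ card K * real_of_int (poly (Q_poly n k) (1 - 2 ^ ((k choose 2) - 1)))"
    unfolding prob_erdos_renyi_half X_def[symmetric] by simp
  moreover have "(- 1 / M) ^ card K =
      (- 1) ^ (n choose k) * 2 powi ((1 - int (k choose 2)) * int (n choose k))"
  proof -
    \<comment> \<open>Positivity keeps the natural-number subtraction in the exponent of
      \<open>M\<close> from truncating.\<close>
    have "0 < k choose 2"
      using assms(1) by simp
    then have "1 - int (k choose 2) = - int ((k choose 2) - 1)"
      by linarith
    then have "1 / M = 2 powi (1 - int (k choose 2))"
      by (simp only: M_def power_int_minus power_int_of_nat inverse_eq_divide)
    then have "(1 / M) ^ card K = 2 powi ((1 - int (k choose 2)) * int (n choose k))"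
      by (simp add: cardK power_int_mult)
    moreover have "(- 1 / M) ^ card K = (- 1) ^ card K * (1 / M) ^ card K"
      unfolding power_mult_distrib[symmetric] by simp
    ultimately show ?thesis
      by (simp only: cardK)
  qed
  ultimately show ?thesis
    by simp
qed

end
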